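(* Let $a>0$. For every $t\in(0,1)$ the three-sheeted Riemann surface associated with the equation $$z=\frac{1-k\zeta}{\zeta\,(1-t(1-t)\zeta)^2},\qquad k=(1-t)(t-a(1-t)),$$ has four branch points at $0$, $\infty$, $p$ and $q$, with $p<q$ real. There is a critical time $t^*=\frac a{a+1}\in(0,1)$ such that Case 1: for $t<t^*$ we have $0<p<q$; Case 2: for $t>t^*$ we have $p<0<q$; Case 3: for $t=t^*$ we have $p=0<q$.
   Context: For given $z$ the equation is cubic in $\zeta$, namely $z\zeta^3-\frac{2z}{t(1-t)}\zeta^2+\left(\frac z{t^2(1-t)^2}+\frac1{t(1-t)}-\frac a{t^2}\right)\zeta-\frac1{t^2(1-t)^2}=0$, and it defines a three-sheeted covering of the Riemann sphere of the variable $z$. Branch points are the points $z$ of the Riemann sphere over which this covering is ramified, counted with multiplicity (in Case 3 the branch points $0$ and $p$ coincide, and $0$ is a branch point of order 2). *)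

theory Defs
  imports "HOL-Complex_Analysis.Complex_Analysis"
begin

datatype riemann_sphere = Fin complex | Infty

text \<open>
  For each point of the sphere, the standard chart centred there (so that the point itself goes
  to \<open>0\<close>), its domain, and its inverse. The value of a chart outside its domain is irrelevant.
\<close>

fun chart_domain :: "riemann_sphere \<Rightarrow> riemann_sphere set" where
  "chart_domain (Fin b) = - {Infty}"
| "chart_domain Infty = - {Fin 0}"

fun chart :: "riemann_sphere \<Rightarrow> riemann_sphere \<Rightarrow> complex" where
  "chart (Fin b) (Fin z) = z - b"
| "chart (Fin b) Infty = 0"
| "chart Infty (Fin z) = 1 / z"
| "chart Infty Infty = 0"

fun chart_inv :: "riemann_sphere \<Rightarrow> complex \<Rightarrow> riemann_sphere" where
  "chart_inv (Fin b) w = Fin (b + w)"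
| "chart_inv Infty w = (if w = 0 then Infty else Fin (1 / w))"

definition in_charts :: "(riemann_sphere \<Rightarrow> riemann_sphere) \<Rightarrow> riemann_sphere \<Rightarrow> complex \<Rightarrow> complex" where
  "in_charts F x = (\<lambda>w. chart (F x) (F (chart_inv x w)))"

definition holomorphic_sphere_map :: "(riemann_sphere \<Rightarrow> riemann_sphere) \<Rightarrow> bool" where
  "holomorphic_sphere_map F \<longleftrightarrow>
     (\<forall>x. (\<forall>\<^sub>F w in nhds 0. F (chart_inv x w) \<in> chart_domain (F x)) \<and>
          in_charts F x analytic_on {0})"

definition ramification_index :: "(riemann_sphere \<Rightarrow> riemann_sphere) \<Rightarrow> riemann_sphere \<Rightarrow> nat" where
  "ramification_index F x = nat (zorder (in_charts F x) 0)"

definition sheeted_covering :: "nat \<Rightarrow> (riemann_sphere \<Rightarrow> riemann_sphere) \<Rightarrow> bool" where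
  "sheeted_covering n F \<longleftrightarrow> holomorphic_sphere_map F \<and>
     (\<forall>y. finite {x. F x = y} \<and> (\<Sum>x\<in>{x. F x = y}. ramification_index F x) = n)"

text \<open>
  The multiplicity of \<open>y\<close> as a branch point (\<open>0\<close> if \<open>F\<close> is unramified over \<open>y\<close>). Note that
  \<open>y\<close> lies in the base of the covering.
\<close>

definition branch_order :: "(riemann_sphere \<Rightarrow> riemann_sphere) \<Rightarrow> riemann_sphere \<Rightarrow> nat" where
  "branch_order F y = (\<Sum>x\<in>{x. F x = y}. ramification_index F x - 1)"

definition has_branch_points :: "(riemann_sphere \<Rightarrow> riemann_sphere) \<Rightarrow> riemann_sphere multiset \<Rightarrow> bool" where
  "has_branch_points F M \<longleftrightarrow> (\<forall>y. branch_order F y = count M y)"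

fun filter_at :: "riemann_sphere \<Rightarrow> complex filter" where
  "filter_at (Fin b) = at b"
| "filter_at Infty = at_infinity"

text \<open>
  The continuous extension of a rational function to the sphere, obtained from punctured limits;
  in particular the totalised value of \<open>f\<close> at a zero of its denominator plays no role.
\<close>

definition sphere_extension :: "(complex \<Rightarrow> complex) \<Rightarrow> riemann_sphere \<Rightarrow> riemann_sphere" where
  "sphere_extension f x =
     (if filterlim f at_infinity (filter_at x) then Infty else Fin (Lim (filter_at x) f))"

definition k_coeff :: "real \<Rightarrow> real \<Rightarrow> real" where
  "k_coeff a t = (1 - t) * (t - a * (1 - t))"

definition z_of_zeta :: "real \<Rightarrow> real \<Rightarrow> complex \<Rightarrow> complex" where
  "z_of_zeta a t \<zeta> =
     (1 - of_real (k_coeff a t) * \<zeta>) / (\<zeta> * (1 - of_real (t * (1 - t)) * \<zeta>)\<^sup>2)"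

text \<open>
  The compact Riemann surface of the equation is the graph of the extended map
  \<open>\<zeta> \<mapsto> z\<close> in the product of the \<open>\<zeta>\<close>-sphere and the \<open>z\<close>-sphere. Since \<open>\<zeta>\<close> is a global
  coordinate on this graph, its projection to the \<open>z\<close>-sphere, i.e. the covering,
  is the following map from the \<open>\<zeta>\<close>-sphere to the \<open>z\<close>-sphere.
\<close>

definition z_covering :: "real \<Rightarrow> real \<Rightarrow> riemann_sphere \<Rightarrow> riemann_sphere" where
  "z_covering a t = sphere_extension (z_of_zeta a t)"

text \<open>
  Consistency: the finite points of this surface are exactly the solutions of the
  equation written as a cubic in \<open>\<zeta>\<close>.
\<close>

lemma z_of_zeta_eq_iff_cubic:
  fixes a t :: real and \<zeta> z :: complex
  assumes "a > 0" "0 < t" "t < 1"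
  defines "c \<equiv> complex_of_real (t * (1 - t))"
  shows "\<zeta> \<noteq> 0 \<and> \<zeta> \<noteq> 1 / c \<and> z = z_of_zeta a t \<zeta> \<longleftrightarrow>
    z * \<zeta>^3 - 2 * z / c * \<zeta>\<^sup>2 + (z / c\<^sup>2 + 1 / c - of_real (a / t\<^sup>2)) * \<zeta> - 1 / c\<^sup>2 = 0"
    (is "_ \<longleftrightarrow> ?P = 0")
proof -
  let ?k = "complex_of_real (k_coeff a t)"
  have c: "c \<noteq> 0" using assms by simp
  have "k_coeff a t = t * (1 - t) - (t * (1 - t))\<^sup>2 * (a / t\<^sup>2)"
    using assms by (simp add: k_coeff_def field_simps power2_eq_square)
  then have k: "?k = c - c\<^sup>2 * of_real (a / t\<^sup>2)"
    unfolding c_def by (metis of_real_diff of_real_mult of_real_power)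
  have "of_real (a / t\<^sup>2) \<noteq> (0::complex)" using assms by simp
  then have kc: "?k \<noteq> c" using c k by simp
  have "c\<^sup>2 * ?P = z * (\<zeta> * (1 - c * \<zeta>)\<^sup>2) - (1 - ?k * \<zeta>)"
    using c unfolding k by (simp add: field_simps power2_eq_square power3_eq_cube)
  then have P: "?P = 0 \<longleftrightarrow> z * (\<zeta> * (1 - c * \<zeta>)\<^sup>2) = 1 - ?k * \<zeta>"
    using c by (metis eq_iff_diff_eq_0 mult_eq_0_iff power_not_zero)
  show ?thesis
  proof (cases "\<zeta> = 0 \<or> \<zeta> = 1 / c")
    case True
    then show ?thesis unfolding P using c kc by auto
  next
    case False
    then have "\<zeta> * (1 - c * \<zeta>)\<^sup>2 \<noteq> 0" using c by (auto simp: field_simps)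
    then show ?thesis
      unfolding P z_of_zeta_def c_def[symmetric] using False by (simp add: eq_divide_eq)
  qed
qed

lemma z_covering_Fin:
  fixes a t :: real and \<zeta> z :: complex
  assumes "a > 0" "0 < t" "t < 1"
  defines "c \<equiv> complex_of_real (t * (1 - t))"
  shows "z_covering a t (Fin \<zeta>) = Fin z \<longleftrightarrow>
    z * \<zeta>^3 - 2 * z / c * \<zeta>\<^sup>2 + (z / c\<^sup>2 + 1 / c - of_real (a / t\<^sup>2)) * \<zeta> - 1 / c\<^sup>2 = 0"
proof -
  let ?f = "z_of_zeta a t" and ?k = "complex_of_real (k_coeff a t)"
  let ?n = "\<lambda>\<zeta>. 1 - ?k * \<zeta>" and ?d = "\<lambda>\<zeta>. \<zeta> * (1 - c * \<zeta>)\<^sup>2"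
  have f: "?f = (\<lambda>\<zeta>. ?n \<zeta> / ?d \<zeta>)" by (simp add: fun_eq_iff z_of_zeta_def c_def)
  have c: "c \<noteq> 0" using assms by simp
  have "k_coeff a t \<noteq> t * (1 - t)"
    using assms by (simp add: k_coeff_def)
  then have kc: "?k \<noteq> c" unfolding c_def by (metis of_real_eq_iff)
  have d0: "?d x = 0 \<longleftrightarrow> x = 0 \<or> x = 1 / c" for x using c by (auto simp: field_simps)
  have "z_covering a t (Fin \<zeta>) = (if ?d \<zeta> = 0 then Infty else Fin (?f \<zeta>))"
  proof (cases "?d \<zeta> = 0")
    case True
    have n: "?n \<zeta> \<noteq> 0" using True[unfolded d0] c kc by (elim disjE) simp_all
    have "(?d \<longlongrightarrow> ?d \<zeta>) (at \<zeta>)" by (intro tendsto_intros)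
    moreover have "\<forall>\<^sub>F x in at \<zeta>. x \<noteq> 0" "\<forall>\<^sub>F x in at \<zeta>. x \<noteq> 1 / c"
      by (rule eventually_neq_at_within)+
    then have "\<forall>\<^sub>F x in at \<zeta>. ?d x \<noteq> 0"
      unfolding d0 by eventually_elim auto
    ultimately have "filterlim ?d (at 0) (at \<zeta>)" using True by (simp add: filterlim_at)
    then have "filterlim (\<lambda>x. inverse (?d x)) at_infinity (at \<zeta>)"
      by (rule filterlim_compose[OF filterlim_inverse_at_infinity])
    moreover have "(?n \<longlongrightarrow> ?n \<zeta>) (at \<zeta>)" by (intro tendsto_intros)
    ultimately have "filterlim (\<lambda>x. ?n x * inverse (?d x)) at_infinity (at \<zeta>)"
      using n by (intro tendsto_mult_filterlim_at_infinity)
    then show ?thesis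
      using True by (simp add: z_covering_def sphere_extension_def f divide_inverse)
  next
    case False
    have "(?f \<longlongrightarrow> ?f \<zeta>) (at \<zeta>)" unfolding f using False by (intro tendsto_intros)
    then have "\<not> filterlim ?f at_infinity (at \<zeta>)" "Lim (at \<zeta>) ?f = ?f \<zeta>"
      by (auto simp: tendsto_Lim dest: not_tendsto_and_filterlim_at_infinity[rotated])
    then show ?thesis using False by (simp add: z_covering_def sphere_extension_def)
  qed
  then show ?thesis
    using z_of_zeta_eq_iff_cubic[OF assms(1-3), of \<zeta> z, folded c_def] d0[of \<zeta>] by auto
qed

end

theory Submission
  imports Defs "HOL-Computational_Algebra.Fundamental_Theorem_Algebra"
begin

text \<open>
  Over \<open>y\<close> the covering given by a quotient \<open>N / D\<close> of coprime polynomials has as its finite points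
  the roots of \<open>N - z D\<close> (for \<open>y = z\<close> finite) or of \<open>D\<close> (for \<open>y = \<infinity>\<close>), with the root
  multiplicities as ramification indices; the point \<open>\<infinity>\<close> takes up the drop of the degree. At
  finite points the excess of the ramification index over \<open>1\<close> is the multiplicity of the root of
  the Wronskian \<open>N' D - N D'\<close>. With \<open>c = t (1 - t)\<close> and \<open>v = 1 / (c \<zeta>)\<close>, this Wronskian
  vanishes at \<open>v = 1\<close>, which lies over \<open>\<infinity>\<close>, and at the roots \<open>v = (3 \<plusminus> r) / 2\<close> of
  \<open>v\<^sup>2 - 3 v + 2 k / c\<close>, where \<open>r\<^sup>2 = 1 + 8 a (1 - t) / t\<close>. The branch points belonging to
  these two roots are
  \<open>q = c (r + 3)\<^sup>3 / (8 (r + 1))\<close> and \<open>p = c (r - 3)\<^sup>3 / (8 (r - 1))\<close>, so that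
  \<open>q - p = 2 c r\<^sup>3 / (r\<^sup>2 - 1) > 0\<close>, and the sign of \<open>p\<close> is that of \<open>r - 3\<close>, i.e. of
  \<open>a / (a + 1) - t\<close>.
\<close>

section \<open>Rational functions in the charts of the sphere\<close>

definition ratio :: "complex \<Rightarrow> complex \<Rightarrow> riemann_sphere" where
  "ratio n e = (if e = 0 then Infty else Fin (n / e))"

definition fibre_poly :: "complex poly \<Rightarrow> complex poly \<Rightarrow> riemann_sphere \<Rightarrow> complex poly" where
  "fibre_poly N D y = (case y of Fin z \<Rightarrow> N - smult z D | Infty \<Rightarrow> D)"

lemma ratio_eq_iff_fibre_poly:
  assumes "poly N x \<noteq> 0 \<or> poly D x \<noteq> 0"
  shows "ratio (poly N x) (poly D x) = y \<longleftrightarrow> poly (fibre_poly N D y) x = 0"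
  using assms by (cases y) (auto simp: ratio_def fibre_poly_def field_simps)

lemma eventually_poly_nonzero_nhds:
  fixes P :: "complex poly"
  assumes "poly P b \<noteq> 0"
  shows "\<forall>\<^sub>F w in nhds b. poly P w \<noteq> 0"
proof -
  have "open {w. poly P w \<noteq> 0}" by (intro open_Collect_neq continuous_intros)
  from eventually_nhds_in_open[OF this, of b] assms show ?thesis by simp
qed

lemma eventually_poly_nonzero_at:
  fixes P :: "complex poly"
  assumes "P \<noteq> 0"
  shows "\<forall>\<^sub>F w in at b. poly P w \<noteq> 0"
proof -
  have "open (- ({x. poly P x = 0} - {b}))"
    using assms by (intro open_Compl finite_imp_closed finite_Diff poly_roots_finite)
  then have "\<forall>\<^sub>F w in nhds b. w \<in> - ({x. poly P x = 0} - {b})"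
    by (rule eventually_nhds_in_open) simp
  then show ?thesis by (auto simp: eventually_at_filter elim: eventually_mono)
qed

lemma sphere_extension_cong:
  assumes "\<forall>\<^sub>F x in filter_at y. f x = g x"
  shows "sphere_extension f y = sphere_extension g y"
  using filterlim_cong[OF refl refl assms, of at_infinity] Lim_cong[OF assms refl]
  by (simp add: sphere_extension_def)

text \<open>Inversion carries the punctured neighbourhoods of 0 to those of infinity, so limits at
  infinity reduce to limits at a finite point.\<close>

lemma sphere_extension_Infty:
  "sphere_extension f Infty = sphere_extension (\<lambda>w. f (inverse w)) (Fin 0)"
proof -
  have inf: "(at_infinity :: complex filter) = filtermap inverse (at 0)"
    by (simp add: at_to_infinity filtermap_filtermap)
  show ?thesis
    by (simp add: sphere_extension_def inf filterlim_filtermap t2_space_class.Lim_def)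
qed

lemma sphere_extension_rational:
  assumes "D \<noteq> 0" and nz: "poly N b \<noteq> 0 \<or> poly D b \<noteq> 0"
  shows "sphere_extension (\<lambda>x. poly N x / poly D x) (Fin b) = ratio (poly N b) (poly D b)"
proof (cases "poly D b = 0")
  case True
  have "(poly D \<longlongrightarrow> 0) (at b)"
    using poly_isCont[of b D] True by (simp add: isCont_def)
  then have "filterlim (poly D) (at 0) (at b)"
    using eventually_poly_nonzero_at[OF assms(1)] by (simp add: filterlim_at)
  then have "filterlim (\<lambda>x. inverse (poly D x)) at_infinity (at b)"
    by (rule filterlim_compose[OF filterlim_inverse_at_infinity])
  moreover have "(poly N \<longlongrightarrow> poly N b) (at b)"
    using poly_isCont[of b N] by (simp add: isCont_def)
  ultimately have "filterlim (\<lambda>x. poly N x * inverse (poly D x)) at_infinity (at b)"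
    using nz True by (intro tendsto_mult_filterlim_at_infinity) auto
  then show ?thesis
    using True by (simp add: sphere_extension_def ratio_def divide_inverse)
next
  case False
  have "((\<lambda>x. poly N x / poly D x) \<longlongrightarrow> poly N b / poly D b) (at b)"
    using False by (intro tendsto_intros) (use poly_isCont isCont_def in blast)+
  then have "\<not> filterlim (\<lambda>x. poly N x / poly D x) at_infinity (at b)"
    "Lim (at b) (\<lambda>x. poly N x / poly D x) = poly N b / poly D b"
    by (auto simp: tendsto_Lim dest: not_tendsto_and_filterlim_at_infinity[rotated])
  then show ?thesis using False by (simp add: sphere_extension_def ratio_def)
qed

text \<open>For y = z finite, N/D - z = (N - z D)/D; over infinity the chart gives D/N. So
  \<open>E\<close> is \<open>D\<close> or \<open>N\<close>, and only the fibre polynomial can vanish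
  at \<open>b\<close>.\<close>

lemma chart_ratio:
  assumes nz: "poly N b \<noteq> 0 \<or> poly D b \<noteq> 0"
  defines "y \<equiv> ratio (poly N b) (poly D b)"
  obtains E where "poly E b \<noteq> 0"
    "\<forall>\<^sub>F w in nhds b. ratio (poly N w) (poly D w) \<in> chart_domain y \<and>
      chart y (ratio (poly N w) (poly D w)) = poly (fibre_poly N D y) w / poly E w"
proof (cases "poly D b = 0")
  case True
  with nz have n: "poly N b \<noteq> 0" by simp
  have "\<forall>\<^sub>F w in nhds b. ratio (poly N w) (poly D w) \<in> chart_domain y \<and>
      chart y (ratio (poly N w) (poly D w)) = poly (fibre_poly N D y) w / poly N w"
    using eventually_poly_nonzero_nhds[OF n]
    by eventually_elim (use True in \<open>auto simp: y_def ratio_def fibre_poly_def\<close>)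
  with n show ?thesis by (rule that)
next
  case False
  have "\<forall>\<^sub>F w in nhds b. ratio (poly N w) (poly D w) \<in> chart_domain y \<and>
      chart y (ratio (poly N w) (poly D w)) = poly (fibre_poly N D y) w / poly D w"
    using eventually_poly_nonzero_nhds[OF False]
    by eventually_elim (use False in \<open>auto simp: y_def ratio_def fibre_poly_def diff_divide_distrib\<close>)
  with False show ?thesis by (rule that)
qed

lemma zorder_poly_quotient:
  fixes Q E :: "complex poly"
  assumes "Q \<noteq> 0" "poly E b \<noteq> 0"
  shows "zorder (\<lambda>w. poly Q w / poly E w) b = order b Q"
proof -
  obtain R where R: "Q = [:- b, 1:] ^ order b Q * R" "\<not> [:- b, 1:] dvd R"
    using order_decomp[OF assms(1)] by blast
  let ?S = "{w. poly E w \<noteq> 0}"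
  have "open ?S" by (intro open_Collect_neq continuous_intros)
  moreover have "(\<lambda>w. poly R w / poly E w) holomorphic_on ?S"
    by (intro holomorphic_intros) auto
  moreover have "poly R b / poly E b \<noteq> 0" using R(2) assms(2) by (simp add: poly_eq_0_iff_dvd)
  moreover have "poly Q w / poly E w = poly R w / poly E w * (w - b) powi int (order b Q)" for w
    by (subst R(1)) (simp add: mult.commute)
  ultimately show ?thesis using assms(2)
    by (intro zorder_eqI[where S = ?S and g = "\<lambda>w. poly R w / poly E w"]) blast+
qed

text \<open>\<open>H\<close> is kept abstract to serve two charts: the one at a finite point
  \<open>b\<close>, and the one at infinity, with b = 0 and reversed polynomials.\<close>

lemma chart_ratio_shifted:
  assumes nz: "poly N b \<noteq> 0 \<or> poly D b \<noteq> 0"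
    and H: "\<And>w. H w = ratio (poly N (b + w)) (poly D (b + w))"
  shows "\<forall>\<^sub>F w in nhds 0. H w \<in> chart_domain (H 0)"
    and "(\<lambda>w. chart (H 0) (H w)) analytic_on {0}"
    and "fibre_poly N D (H 0) \<noteq> 0 \<Longrightarrow>
      zorder (\<lambda>w. chart (H 0) (H w)) 0 = order b (fibre_poly N D (H 0))"
proof -
  have H0: "H 0 = ratio (poly N b) (poly D b)" using H[of 0] by simp
  obtain E where E: "poly E b \<noteq> 0"
    "\<forall>\<^sub>F w in nhds b. ratio (poly N w) (poly D w) \<in> chart_domain (H 0) \<and>
      chart (H 0) (ratio (poly N w) (poly D w)) = poly (fibre_poly N D (H 0)) w / poly E w"
    using chart_ratio[OF nz] unfolding H0 by blast
  let ?g = "\<lambda>w. poly (fibre_poly N D (H 0)) w / poly E w"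
  have ev: "\<forall>\<^sub>F w in nhds 0. H w \<in> chart_domain (H 0) \<and> chart (H 0) (H w) = ?g (b + w)"
    using E(2) by (subst (asm) nhds_to_0) (simp add: eventually_filtermap H)
  then show "\<forall>\<^sub>F w in nhds 0. H w \<in> chart_domain (H 0)" by eventually_elim simp
  from ev have ev': "\<forall>\<^sub>F w in nhds 0. chart (H 0) (H w) = ?g (b + w)" by eventually_elim simp
  have "(\<lambda>w. poly P (b + w)) analytic_on {0}" for P :: "complex poly"
    by (rule analytic_on_subset[of _ UNIV]) (simp_all add: analytic_on_open holomorphic_intros)
  then have "(\<lambda>w. ?g (b + w)) analytic_on {0}" using E(1) by (intro analytic_on_divide) auto
  with ev' show "(\<lambda>w. chart (H 0) (H w)) analytic_on {0}" by (subst analytic_at_cong[OF _ refl])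
  assume nz: "fibre_poly N D (H 0) \<noteq> 0"
  have "zorder (\<lambda>w. chart (H 0) (H w)) 0 = zorder (\<lambda>w. ?g (w + b)) 0"
    using ev' by (intro zorder_cong) (auto simp: eventually_at_filter add_ac elim: eventually_mono)
  also have "\<dots> = zorder ?g b" by (rule zorder_shift[symmetric])
  also have "\<dots> = order b (fibre_poly N D (H 0))" by (rule zorder_poly_quotient[OF nz E(1)])
  finally show "zorder (\<lambda>w. chart (H 0) (H w)) 0 = order b (fibre_poly N D (H 0))" .
qed

section \<open>The point at infinity: reversed polynomials\<close>

definition reverse_poly :: "nat \<Rightarrow> complex poly \<Rightarrow> complex poly" where
  "reverse_poly d P = monom 1 (d - degree P) * reflect_poly P"

lemma coeff_reverse_poly:
  assumes "degree P \<le> d"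
  shows "coeff (reverse_poly d P) i = (if i \<le> d then coeff P (d - i) else 0)"
  using assms
  by (auto simp: reverse_poly_def coeff_monom_mult coeff_reflect_poly coeff_eq_0 intro!: arg_cong[of _ _ "coeff P"])

lemma poly_reverse_poly:
  assumes "degree P \<le> d" "w \<noteq> 0"
  shows "poly (reverse_poly d P) w = w ^ d * poly P (inverse w)"
  using assms by (simp add: reverse_poly_def poly_monom poly_reflect_poly_nz flip: power_add mult.assoc)

lemma order_0_reverse_poly:
  assumes "P \<noteq> 0"
  shows "order 0 (reverse_poly d P) = d - degree P"
proof -
  have "order 0 (reflect_poly P) = 0" using assms by (intro order_0I) (simp add: poly_0_coeff_0)
  then show ?thesis using assms by (simp add: reverse_poly_def order_mult monom_eq_0_iff)
qed

text \<open>Reversal to a fixed degree \<open>d\<close> is linear, whereas reversal of each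
  polynomial to its own degree is not; hence the monomial factor in
  \<open>reverse_poly\<close>.\<close>

lemma fibre_poly_reverse_poly:
  assumes "degree N \<le> d" "degree D \<le> d"
  shows "fibre_poly (reverse_poly d N) (reverse_poly d D) y = reverse_poly d (fibre_poly N D y)"
proof -
  have "degree (N - smult z D) \<le> d" for z
    using assms by (intro degree_diff_le) (auto intro: order.trans[OF degree_smult_le])
  then show ?thesis
    using assms by (cases y) (auto simp: fibre_poly_def poly_eq_iff coeff_reverse_poly)
qed

section \<open>Order of vanishing of a Wronskian\<close>

lemma order_wronskian:
  fixes Q E :: "complex poly"
  assumes "Q \<noteq> 0" "poly E b \<noteq> 0" "poly Q b = 0"
  shows "order b (pderiv Q * E - Q * pderiv E) = order b Q - 1"
proof -
  define L where "L = [:- b, 1:]"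
  obtain n where n: "order b Q = Suc n"
    using assms by (metis order_root not0_implies_Suc)
  obtain R where R: "Q = L ^ Suc n * R" "\<not> L dvd R"
    using order_decomp[OF assms(1), of b] unfolding n L_def by blast
  \<comment> \<open>The cofactor of L^n in the Wronskian. As \<open>L\<close> vanishes at
    \<open>b\<close>, S(b) = (n + 1) R(b) E(b), which is nonzero.\<close>
  define S where "S = smult (of_nat (Suc n)) (R * E) + L * (pderiv R * E - R * pderiv E)"
  have "pderiv L = 1" by (simp add: L_def pderiv_pCons)
  then have "pderiv Q = L ^ n * (smult (of_nat (Suc n)) R + L * pderiv R)"
    unfolding R(1) pderiv_mult pderiv_power_Suc by (simp add: algebra_simps del: of_nat_Suc)
  then have W: "pderiv Q * E - Q * pderiv E = L ^ n * S"
    by (simp add: R(1) S_def algebra_simps del: of_nat_Suc)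
  have Sb: "poly S b \<noteq> 0"
    using R(2) assms(2) by (simp add: S_def L_def poly_eq_0_iff_dvd del: of_nat_Suc)
  then have "S \<noteq> 0" by auto
  then have "order b (L ^ n * S) = order b (L ^ n) + order b S"
    by (intro order_mult) (simp add: L_def)
  then show ?thesis
    using Sb order_power_n_n[of b n] by (simp add: W n L_def order_0I)
qed

section \<open>The covering defined by a quotient of coprime polynomials\<close>

locale rational_map =
  fixes N D :: "complex poly" and d :: nat
  assumes no_common_root: "poly N x \<noteq> 0 \<or> poly D x \<noteq> 0"
    and D_nonzero: "D \<noteq> 0"
    and d_def: "d = max (degree N) (degree D)"
    and d_pos: "d > 0"
begin

definition F :: "riemann_sphere \<Rightarrow> riemann_sphere" where
  "F = sphere_extension (\<lambda>x. poly N x / poly D x)"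

abbreviation "Q \<equiv> fibre_poly N D"

lemma degree_N: "degree N \<le> d" and degree_D: "degree D \<le> d"
  by (simp_all add: d_def)

text \<open>Otherwise \<open>N\<close> would be a constant multiple of \<open>D\<close>; then
  \<open>D\<close> is nonconstant and any of its roots is a common root.\<close>

lemma Q_nonzero: "Q y \<noteq> 0"
proof (cases y)
  case (Fin z)
  show ?thesis
  proof
    assume "Q y = 0"
    then have N: "N = smult z D" by (simp add: Fin fibre_poly_def)
    then have "degree D > 0" using d_pos by (simp add: d_def split: if_splits)
    then have "\<not> constant (poly D)" by (simp add: constant_degree)
    then obtain x where "poly D x = 0" using fundamental_theorem_of_algebra by blast
    then show False using no_common_root[of x] N by simp
  qed
qed (simp add: fibre_poly_def D_nonzero)

lemma degree_Q: "degree (Q y) \<le> d"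
  using degree_N degree_D
  by (cases y) (auto simp: fibre_poly_def intro!: degree_diff_le order.trans[OF degree_smult_le])

lemma F_Fin: "F (Fin x) = ratio (poly N x) (poly D x)"
  unfolding F_def by (rule sphere_extension_rational[OF D_nonzero no_common_root])

text \<open>At 0 the values are the coefficients of degree \<open>d\<close>, which do not both
  vanish since \<open>d\<close> is the larger of the two degrees.\<close>

lemma reverse_no_common_root:
  "poly (reverse_poly d N) w \<noteq> 0 \<or> poly (reverse_poly d D) w \<noteq> 0"
proof (cases "w = 0")
  case True
  have "coeff N d \<noteq> 0 \<or> coeff D d \<noteq> 0"
    using d_pos by (metis d_def degree_0 leading_coeff_0_iff less_irrefl max_def)
  then show ?thesis
    using True degree_N degree_D by (simp add: poly_0_coeff_0 coeff_reverse_poly)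
next
  case False
  then show ?thesis
    using no_common_root[of "inverse w"] degree_N degree_D by (simp add: poly_reverse_poly)
qed

lemma F_chart_inv_Infty:
  "F (chart_inv Infty w) = ratio (poly (reverse_poly d N) w) (poly (reverse_poly d D) w)"
proof (cases "w = 0")
  case True
  have "\<forall>\<^sub>F w in filter_at (Fin 0). poly N (inverse w) / poly D (inverse w) =
      poly (reverse_poly d N) w / poly (reverse_poly d D) w"
    using eventually_neq_at_within[of 0 0 UNIV] unfolding filter_at.simps
    by eventually_elim (simp add: poly_reverse_poly degree_N degree_D)
  then have "F Infty = sphere_extension
      (\<lambda>w. poly (reverse_poly d N) w / poly (reverse_poly d D) w) (Fin 0)"
    unfolding F_def sphere_extension_Infty by (rule sphere_extension_cong)
  moreover have "reverse_poly d D \<noteq> 0"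
    using D_nonzero by (simp add: reverse_poly_def monom_eq_0_iff)
  ultimately show ?thesis
    using True sphere_extension_rational reverse_no_common_root by auto
next
  case False
  then show ?thesis
    by (simp add: F_Fin ratio_def poly_reverse_poly degree_N degree_D inverse_eq_divide)
qed

lemma F_Fin_eq_iff: "F (Fin x) = y \<longleftrightarrow> poly (Q y) x = 0"
  unfolding F_Fin by (rule ratio_eq_iff_fibre_poly[OF no_common_root])

text \<open>The reversed fibre polynomial takes at 0 the coefficient of degree
  \<open>d\<close>.\<close>

lemma F_Infty_eq_iff: "F Infty = y \<longleftrightarrow> degree (Q y) < d"
proof -
  have "F Infty = y \<longleftrightarrow> poly (reverse_poly d (Q y)) 0 = 0"
    using F_chart_inv_Infty[of 0] ratio_eq_iff_fibre_poly[OF reverse_no_common_root[of 0], of y]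
    by (simp add: fibre_poly_reverse_poly degree_N degree_D)
  also have "\<dots> \<longleftrightarrow> coeff (Q y) d = 0"
    using degree_Q by (simp add: poly_0_coeff_0 coeff_reverse_poly)
  also have "\<dots> \<longleftrightarrow> degree (Q y) < d"
    using degree_Q[of y] Q_nonzero[of y] by (metis coeff_eq_0 leading_coeff_0_iff nat_less_le)
  finally show ?thesis .
qed

lemma holomorphic_sphere_map_F: "holomorphic_sphere_map F"
  and ramification_index_Fin: "ramification_index F (Fin x) = order x (Q (F (Fin x)))"
  and ramification_index_Infty: "ramification_index F Infty = d - degree (Q (F Infty))"
proof -
  note fin = chart_ratio_shifted[OF no_common_root, of "\<lambda>w. F (Fin (x + w))" x for x,
      OF F_Fin, simplified add_0_right]
  have "F (chart_inv Infty w) = ratio (poly (reverse_poly d N) (0 + w)) (poly (reverse_poly d D) (0 + w))" for w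
    using F_chart_inv_Infty by simp
  note inf = chart_ratio_shifted[OF reverse_no_common_root, of "\<lambda>w. F (chart_inv Infty w)" 0,
      OF this]
  have 0: "chart_inv Infty 0 = Infty" by simp
  show "holomorphic_sphere_map F"
    unfolding holomorphic_sphere_map_def in_charts_def
  proof
    fix x
    show "(\<forall>\<^sub>F w in nhds 0. F (chart_inv x w) \<in> chart_domain (F x)) \<and>
      (\<lambda>w. chart (F x) (F (chart_inv x w))) analytic_on {0}"
    proof (cases x)
      case (Fin b)
      then show ?thesis using fin(1,2)[of b] by simp
    next
      case Infty
      then show ?thesis using inf(1,2) unfolding 0 by blast
    qed
  qed
  show "ramification_index F (Fin x) = order x (Q (F (Fin x)))"
    using fin(3)[of x, OF Q_nonzero] by (simp add: ramification_index_def in_charts_def)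
  have rev: "fibre_poly (reverse_poly d N) (reverse_poly d D) (F Infty) = reverse_poly d (Q (F Infty))"
    by (rule fibre_poly_reverse_poly[OF degree_N degree_D])
  have "reverse_poly d (Q (F Infty)) \<noteq> 0"
    using Q_nonzero by (simp add: reverse_poly_def monom_eq_0_iff)
  then have "zorder (\<lambda>w. chart (F Infty) (F (chart_inv Infty w))) 0 = d - degree (Q (F Infty))"
    using inf(3) unfolding 0 rev order_0_reverse_poly[OF Q_nonzero] by (elim meta_mp)
  then show "ramification_index F Infty = d - degree (Q (F Infty))"
    unfolding ramification_index_def in_charts_def by (simp only: nat_int)
qed

lemma fibre: "{x. F x = y} = Fin ` {x. poly (Q y) x = 0} \<union> (if degree (Q y) < d then {Infty} else {})"
proof -
  have "x \<in> {x. F x = y} \<longleftrightarrow>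
      x \<in> Fin ` {x. poly (Q y) x = 0} \<union> (if degree (Q y) < d then {Infty} else {})" for x
    by (cases x) (auto simp: F_Fin_eq_iff F_Infty_eq_iff)
  then show ?thesis by blast
qed

lemma finite_fibre: "finite {x. F x = y}"
  unfolding fibre using Q_nonzero by (simp add: poly_roots_finite)

lemma sheeted_covering_F: "sheeted_covering d F"
  unfolding sheeted_covering_def
proof (intro conjI allI holomorphic_sphere_map_F finite_fibre)
  fix y
  let ?Z = "{x. poly (Q y) x = 0}"
  let ?I = "if degree (Q y) < d then {Infty} else {}"
  have "(\<Sum>x\<in>Fin ` ?Z. ramification_index F x) = (\<Sum>x\<in>?Z. order x (Q y))"
    by (subst sum.reindex)
      (auto simp: inj_on_def ramification_index_Fin F_Fin_eq_iff[symmetric] intro!: sum.cong)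
  also have "\<dots> = size (proots (Q y))"
    using Q_nonzero by (simp add: size_multiset_overloaded_eq)
  also have "\<dots> = degree (Q y)" by (rule size_proots_complex)
  finally have fin: "(\<Sum>x\<in>Fin ` ?Z. ramification_index F x) = degree (Q y)" .
  \<comment> \<open>If the degree is \<open>d\<close>, infinity is not in the fibre and both sides
    are 0.\<close>
  have inf: "(\<Sum>x\<in>?I. ramification_index F x) = d - degree (Q y)"
    using F_Infty_eq_iff[of y] by (auto simp: ramification_index_Infty)
  have "(\<Sum>x\<in>{x. F x = y}. ramification_index F x) = degree (Q y) + (d - degree (Q y))"
    unfolding fibre using Q_nonzero
    by (subst sum.union_disjoint) (auto simp: fin inf poly_roots_finite)
  then show "(\<Sum>x\<in>{x. F x = y}. ramification_index F x) = d"
    using degree_Q[of y] by simp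
qed

definition W :: "complex poly" where
  "W = pderiv N * D - N * pderiv D"

text \<open>The Wronskian is unchanged when \<open>N\<close> is replaced by N - z D and changes sign
  when \<open>N\<close> and \<open>D\<close> are exchanged. At each finite point it thus pairs, up
  to sign, the fibre polynomial with a polynomial not vanishing there.\<close>

lemma order_W: "order x W = ramification_index F (Fin x) - 1"
proof (cases "poly D x = 0")
  case True
  then have "poly N x \<noteq> 0" using no_common_root by auto
  then have "order x (pderiv D * N - D * pderiv N) = order x D - 1"
    using True by (intro order_wronskian D_nonzero)
  moreover have "W = - (pderiv D * N - D * pderiv N)"
    by (simp add: W_def algebra_simps)
  moreover have "F (Fin x) = Infty" using True by (simp add: F_Fin ratio_def)
  ultimately show ?thesis by (simp only: ramification_index_Fin fibre_poly_def order_uminus riemann_sphere.case)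
next
  case False
  then obtain z where z: "F (Fin x) = Fin z" by (simp add: F_Fin ratio_def)
  have "poly (Q (Fin z)) x = 0" using z F_Fin_eq_iff by blast
  then have "order x (pderiv (Q (Fin z)) * D - Q (Fin z) * pderiv D) = order x (Q (Fin z)) - 1"
    using False by (intro order_wronskian Q_nonzero)
  moreover have "W = pderiv (Q (Fin z)) * D - Q (Fin z) * pderiv D"
    by (simp add: W_def fibre_poly_def pderiv_diff pderiv_smult algebra_simps)
  ultimately show ?thesis by (simp add: z ramification_index_Fin)
qed

lemma has_branch_points_F:
  assumes "W \<noteq> 0"
  shows "has_branch_points F (image_mset F
    (image_mset Fin (proots W) + replicate_mset (ramification_index F Infty - 1) Infty))"
    (is "has_branch_points F (image_mset F ?M)")
  unfolding has_branch_points_def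
proof
  fix y
  have "count ?M x = ramification_index F x - 1" for x
  proof (cases x)
    case (Fin b)
    have "count (image_mset Fin (proots W)) (Fin b) = order b W"
      using assms by (auto simp: count_image_mset vimage_def order_root Int_insert_left)
    then show ?thesis by (simp add: Fin order_W)
  next
    case Infty
    then show ?thesis by (auto simp: count_eq_zero_iff)
  qed
  then have "branch_order F y = (\<Sum>x\<in>{x. F x = y}. count ?M x)"
    by (simp add: branch_order_def)
  \<comment> \<open>Unramified points have count 0, so the sum restricts to the support, as the
    count in an image multiset requires.\<close>
  also have "\<dots> = (\<Sum>x\<in>{x. F x = y} \<inter> set_mset ?M. count ?M x)"
    by (rule sum.mono_neutral_right[OF finite_fibre]) (blast intro: iffD1[OF not_in_iff])+
  also have "\<dots> = count (image_mset F ?M) y"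
    unfolding count_image_mset by (rule sum.cong) auto
  finally show "branch_order F y = count (image_mset F ?M) y" .
qed

end

section \<open>Ramification of the three-sheeted covering\<close>

lemma proots_one_minus:
  fixes v :: complex
  shows "proots [:1, - v:] = (if v = 0 then {#} else {#1 / v#})"
proof (cases "v = 0")
  case False
  then have "[:1, - v:] = smult (- v) [:- (1 / v), 1:]" by simp
  then have "proots [:1, - v:] = proots [:- (1 / v), 1:]"
    using False by (metis neg_equal_0_iff_equal proots_smult)
  then show ?thesis using False proots_linear_factor[of "- (1 / v)"] by simp
qed simp

text \<open>
  In the coordinate \<open>v = 1 / (c \<zeta>)\<close> the ramification points with \<open>z \<noteq> \<infinity>\<close> are the two roots of
  \<open>v\<^sup>2 - 3 v + 2 k / c\<close>; the root \<open>v = 0\<close>, which occurs for \<open>k = 0\<close>, accounts for the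
  additional ramification at \<open>\<zeta> = \<infinity>\<close>.
\<close>

lemma z_covering_branch_points:
  fixes a t v\<^sub>1 v\<^sub>2 :: real
  assumes "a > 0" "0 < t" "t < 1"
  defines "c \<equiv> t * (1 - t)"
  assumes v_sum: "v\<^sub>1 + v\<^sub>2 = 3" and v_prod: "c * (v\<^sub>1 * v\<^sub>2) = 2 * k_coeff a t"
    and v_ne: "v\<^sub>1 \<noteq> 0" "v\<^sub>1 \<noteq> 1" "v\<^sub>2 \<noteq> 1"
  defines "val \<equiv> \<lambda>v. c * v ^ 3 / (2 * (v - 1))"
  shows "sheeted_covering 3 (z_covering a t)"
    and "has_branch_points (z_covering a t)
      {#Fin 0, Infty, Fin (of_real (val v\<^sub>2)), Fin (of_real (val v\<^sub>1))#}"
proof -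
  define C where "C = complex_of_real c"
  define K where "K = complex_of_real (k_coeff a t)"
  define V\<^sub>1 where "V\<^sub>1 = complex_of_real v\<^sub>1"
  define V\<^sub>2 where "V\<^sub>2 = complex_of_real v\<^sub>2"
  define N where "N = [:1, - K:]"
  define D where "D = [:0, 1:] * [:1, - C:]\<^sup>2"
  have C: "C \<noteq> 0" using assms(1-3) by (simp add: C_def c_def)
  \<comment> \<open>Indeed c - k = a (1 - t)^2 > 0.\<close>
  have KC: "K \<noteq> C"
    using assms(1-3) by (simp add: K_def C_def c_def k_coeff_def)
  have V_sum: "V\<^sub>1 + V\<^sub>2 = 3"
    unfolding V\<^sub>1_def V\<^sub>2_def using v_sum by (metis of_real_add of_real_numeral)
  have V_prod: "2 * K = C * (V\<^sub>1 * V\<^sub>2)"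
    unfolding V\<^sub>1_def V\<^sub>2_def C_def K_def using v_prod by (metis of_real_mult of_real_numeral)
  have V_ne: "V\<^sub>1 \<noteq> 0" "V\<^sub>1 \<noteq> 1" "V\<^sub>2 \<noteq> 1"
    using v_ne by (simp_all add: V\<^sub>1_def V\<^sub>2_def)
  have polys: "poly N x = 1 - K * x" "poly D x = x * (1 - C * x)\<^sup>2" for x
    by (simp_all add: N_def D_def algebra_simps)
  have deg_D: "degree D = 3"
    using C by (simp add: D_def degree_mult_eq degree_power_eq)
  have deg_N: "degree N = (if K = 0 then 0 else 1)" by (simp add: N_def)
  interpret rational_map N D 3
  proof
    show "poly N x \<noteq> 0 \<or> poly D x \<noteq> 0" for x
    proof (cases "x = 0")
      case False
      with KC have "K * x \<noteq> 1 \<or> C * x \<noteq> 1" by (metis mult_right_cancel)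
      with False show ?thesis unfolding polys by auto
    qed (simp add: polys)
    show "D \<noteq> 0" using deg_D by auto
    show "3 = max (degree N) (degree D)" by (simp add: deg_D deg_N)
  qed simp
  have F: "z_covering a t = F"
    by (simp add: z_covering_def F_def z_of_zeta_def[abs_def] polys K_def C_def c_def)
  show "sheeted_covering 3 (z_covering a t)"
    unfolding F by (rule sheeted_covering_F)

  \<comment> \<open>Differentiation gives -(1 - C x)(1 - 3 C x + 2 K C x^2); the sum and product of
    the \<open>V\<close> split the quadratic factor.\<close>
  have W: "W = - ([:1, - C:] * ([:1, - (C * V\<^sub>1):] * [:1, - (C * V\<^sub>2):]))"
  proof -
    have "[:1, - (C * V\<^sub>1):] * [:1, - (C * V\<^sub>2):] = [:1, - (C * (V\<^sub>1 + V\<^sub>2)), C * (C * (V\<^sub>1 * V\<^sub>2)):]"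
      by (simp add: algebra_simps)
    also have "\<dots> = [:1, - 3 * C, 2 * K * C:]"
      unfolding V_sum V_prod[symmetric] by (simp add: algebra_simps)
    finally have "[:1, - (C * V\<^sub>1):] * [:1, - (C * V\<^sub>2):] = [:1, - 3 * C, 2 * K * C:]" .
    moreover have "W = - ([:1, - C:] * [:1, - 3 * C, 2 * K * C:])"
      unfolding W_def unfolding N_def D_def power2_eq_square
      by (simp add: pderiv_pCons algebra_simps)
    ultimately show ?thesis by (simp only:)
  qed
  then have "W \<noteq> 0" by simp
  have proots_W: "proots W = {#1 / C, 1 / (C * V\<^sub>1)#} +
      (if V\<^sub>2 = 0 then {#} else {#1 / (C * V\<^sub>2)#})"
    unfolding W proots_uminus using C V_ne
    by (subst proots_mult, simp, simp, subst proots_mult) (simp_all add: proots_one_minus)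

  have F_1: "F (Fin (1 / C)) = Infty" using C by (simp add: F_Fin ratio_def polys)
  \<comment> \<open>At x = 1/(C V), K x = (3 - V)/2 and C x = 1/V, which makes both numerator and
    denominator explicit in V - 1.\<close>
  have F_V: "F (Fin (1 / (C * V))) = Fin (C * V ^ 3 / (2 * (V - 1)))"
    if "V \<noteq> 0" "V \<noteq> 1" "2 * K = C * (V * (3 - V))" for V
  proof -
    have num: "poly N (1 / (C * V)) = (V - 1) / 2"
      using that C by (simp add: polys field_simps)
    have den: "poly D (1 / (C * V)) = (V - 1)\<^sup>2 / (C * V ^ 3)"
      using that C by (simp add: polys field_simps power2_eq_square power3_eq_cube)
    show ?thesis
      using that C by (simp add: F_Fin num den ratio_def power2_eq_square)
  qed
  have F_V1: "F (Fin (1 / (C * V\<^sub>1))) = Fin (C * V\<^sub>1 ^ 3 / (2 * (V\<^sub>1 - 1)))"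
    using V_ne V_prod V_sum by (intro F_V) (auto simp flip: V_sum)
  have F_V2: "F (Fin (1 / (C * V\<^sub>2))) = Fin (C * V\<^sub>2 ^ 3 / (2 * (V\<^sub>2 - 1)))" if "V\<^sub>2 \<noteq> 0"
    using that V_ne V_prod V_sum by (intro F_V) (auto simp: mult.commute simp flip: V_sum)
  have F_Infty: "F Infty = Fin 0"
    unfolding F_Infty_eq_iff by (simp add: fibre_poly_def deg_N)
  \<comment> \<open>The index at infinity is 3 - deg N, which is 3 if K = 0 and 2 otherwise; K = 0
    is equivalent to the second root being 0.\<close>
  have ram_Infty: "ramification_index F Infty - 1 = (if V\<^sub>2 = 0 then 2 else 1)"
    using V_prod C V_ne by (auto simp: ramification_index_Infty F_Infty fibre_poly_def deg_N)
  \<comment> \<open>If the second root is 0, its displayed value is \<open>Fin 0\<close>, supplied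
    by the extra ramification at infinity.\<close>
  have "image_mset F
      (image_mset Fin (proots W) + replicate_mset (ramification_index F Infty - 1) Infty) =
      {#Fin 0, Infty, Fin (C * V\<^sub>2 ^ 3 / (2 * (V\<^sub>2 - 1))), Fin (C * V\<^sub>1 ^ 3 / (2 * (V\<^sub>1 - 1)))#}"
    unfolding proots_W ram_Infty
    by (cases "V\<^sub>2 = 0")
      (simp_all add: F_1 F_V1 F_V2 F_Infty numeral_2_eq_2 add_mset_commute)
  then show "has_branch_points (z_covering a t)
      {#Fin 0, Infty, Fin (of_real (val v\<^sub>2)), Fin (of_real (val v\<^sub>1))#}"
    using has_branch_points_F[OF \<open>W \<noteq> 0\<close>]
    by (simp add: F val_def C_def V\<^sub>1_def V\<^sub>2_def)
qed

section \<open>Explicit branch points and their signs\<close>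

theorem proposition2p3:
  fixes a :: real
  assumes "a > 0"
  shows "\<exists>p q :: real \<Rightarrow> real.
    (\<forall>t\<in>{0<..<1}. sheeted_covering 3 (z_covering a t) \<and>
       has_branch_points (z_covering a t)
         {#Fin 0, Infty, Fin (of_real (p t)), Fin (of_real (q t))#} \<and>
       p t < q t) \<and>
    (\<exists>t_crit. t_crit = a / (a + 1) \<and> t_crit \<in> {0<..<1} \<and>
       (\<forall>t\<in>{0<..<1}.
          (t < t_crit \<longrightarrow> 0 < p t \<and> p t < q t) \<and>
          (t > t_crit \<longrightarrow> p t < 0 \<and> 0 < q t) \<and>
          (t = t_crit \<longrightarrow> p t = 0 \<and> 0 < q t)))"
proof -
  \<comment> \<open>Square root of the discriminant 9 - 8 k/c of v^2 - 3 v + 2 k/c, as k/c = 1 - a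
    (1 - t)/t.\<close>
  define r where "r t = sqrt (1 + 8 * (a * (1 - t) / t))" for t
  define br where "br t v = t * (1 - t) * v ^ 3 / (2 * (v - 1))" for t v :: real
  define p where "p t = br t ((3 - r t) / 2)" for t
  define q where "q t = br t ((3 + r t) / 2)" for t
  have covering: "sheeted_covering 3 (z_covering a t)"
    "has_branch_points (z_covering a t) {#Fin 0, Infty, Fin (of_real (p t)), Fin (of_real (q t))#}"
    and less: "p t < q t" and q_pos: "q t > 0"
    and p_sign: "0 < p t \<longleftrightarrow> t < a / (a + 1)" "p t < 0 \<longleftrightarrow> a / (a + 1) < t"
    if t: "0 < t" "t < 1" for t
  proof -
    define s where "s = a * (1 - t) / t"
    define c where "c = t * (1 - t)"
    have s: "s > 0" and c: "c > 0" using assms t by (simp_all add: s_def c_def)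
    have r: "r t > 1" and r2: "(r t)\<^sup>2 = 1 + 8 * s"
      using s by (simp_all add: r_def s_def[symmetric])
    have "k_coeff a t = c * (1 - s)"
      using t by (simp add: k_coeff_def s_def c_def field_simps)
    then have prod: "c * ((3 + r t) / 2 * ((3 - r t) / 2)) = 2 * k_coeff a t"
      using r2 by (simp add: field_simps power2_eq_square)
    have sum: "(3 + r t) / 2 + (3 - r t) / 2 = 3" by (simp add: field_simps)
    \<comment> \<open>As r > 1, the root (3 + r)/2 exceeds 2 and (3 - r)/2 is below 1. Only the
      latter, which yields \<open>p\<close>, may be 0.\<close>
    have ne: "(3 + r t) / 2 \<noteq> 0" "(3 + r t) / 2 \<noteq> 1" "(3 - r t) / 2 \<noteq> 1"
      using r by auto
    show "sheeted_covering 3 (z_covering a t)"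
      "has_branch_points (z_covering a t) {#Fin 0, Infty, Fin (of_real (p t)), Fin (of_real (q t))#}"
      using z_covering_branch_points[OF assms t sum prod[unfolded c_def] ne]
      unfolding p_def q_def br_def .
    have p: "p t = c * (r t - 3) ^ 3 / (8 * (r t - 1))"
      and q: "q t = c * (r t + 3) ^ 3 / (8 * (r t + 1))"
      using r by (simp_all add: p_def q_def br_def c_def divide_simps)
        (simp_all add: algebra_simps power3_eq_cube)
    have r2_gt: "(r t)\<^sup>2 > 1" using s r2 by simp
    then have "r t * r t \<noteq> 1" by (simp add: power2_eq_square)
    \<comment> \<open>Uses (r + 3)^3 (r - 1) - (r - 3)^3 (r + 1) = 16 r^3.\<close>
    then have "q t - p t = 2 * c * (r t) ^ 3 / ((r t)\<^sup>2 - 1)"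
      using r by (simp add: p q divide_simps) (simp add: algebra_simps power2_eq_square power3_eq_cube)
    then show "p t < q t"
      using c r r2_gt by (smt (verit) divide_pos_pos mult_pos_pos zero_less_power)
    show "q t > 0" using c r by (simp add: q)
    have "0 < p t \<longleftrightarrow> 3 < r t" "p t < 0 \<longleftrightarrow> r t < 3"
      using c r by (auto simp: p zero_less_divide_iff divide_less_0_iff zero_less_mult_iff
        mult_less_0_iff zero_less_power_eq)
    \<comment> \<open>Compare squares: r^2 = 1 + 8 s equals 9 exactly at s = 1.\<close>
    moreover have "3 < r t \<longleftrightarrow> 1 < s" "r t < 3 \<longleftrightarrow> s < 1"
      using abs_le_square_iff[of 3 "r t"] abs_le_square_iff[of "r t" 3] r r2 by auto
    moreover have "1 < s \<longleftrightarrow> t < a / (a + 1)" "s < 1 \<longleftrightarrow> a / (a + 1) < t"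
      using t assms by (auto simp: s_def field_simps)
    ultimately show "0 < p t \<longleftrightarrow> t < a / (a + 1)" "p t < 0 \<longleftrightarrow> a / (a + 1) < t"
      by simp_all
  qed
  have "p t = 0" if "0 < t" "t < 1" "t = a / (a + 1)" for t
    using p_sign[OF that(1,2)] that(3) by linarith
  moreover have "a / (a + 1) \<in> {0<..<1}" using assms by simp
  ultimately show ?thesis
    using covering less q_pos p_sign
    by (intro exI[of _ p] exI[of _ q] exI[of _ "a / (a + 1)"] conjI ballI impI refl) auto
qed

end
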